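(* Let $q\ge 3$ and $p\ge 2$ be integers. Suppose that a connected graph $H$ does not contain a subgraph isomorphic to $S_{q,p}$. Then either $\Delta(H)<q$ or $\Delta(H)\ge (v(H)/3)^{1/(2qp)}$.
   Context: Graphs are finite and simple; "subgraph" means not necessarily induced subgraph. $\Delta(H)$ is the maximum vertex degree of $H$ and $v(H)$ its number of vertices. The sparkler graph $S_{q,p}$ is obtained from the star $K_{1,q-1}$ and the path $P_p$ (on $p$ vertices) by adding an edge between an end vertex of $P_p$ and the central vertex of $K_{1,q-1}$. *)

theory Defs
  imports Complex_Main "Graph_Theory.Graph_Theory"
begin

text \<open>Finite simple graphs are loop-free symmetric digraphs (\<^locale>\<open>pair_graph\<close>): each edge is
  represented by its two arcs, so the degree of a vertex is its out-degree.\<close>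

definition max_degree :: "('a, 'b) pre_digraph \<Rightarrow> nat" where
  "max_degree G = Max (out_degree G ` verts G)"

text \<open>The star on \<open>q\<close> vertices is the \<^const>\<open>Inl\<close> part, with centre \<open>Inl 0\<close>; the path on
  \<open>p\<close> vertices is the \<^const>\<open>Inr\<close> part, with end vertex \<open>Inr 0\<close>.\<close>

definition sparkler_edges :: "nat \<Rightarrow> nat \<Rightarrow> (nat + nat) rel" where
  "sparkler_edges q p =
     {(Inl 0, Inl i) | i. 1 \<le> i \<and> i < q}
   \<union> {(Inr i, Inr (i + 1)) | i. i + 1 < p}
   \<union> {(Inl 0, Inr 0)}"

definition sparkler :: "nat \<Rightarrow> nat \<Rightarrow> (nat + nat) pair_pre_digraph" where
  "sparkler q p =
     \<lparr> pverts = Inl ` {..<q} \<union> Inr ` {..<p},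
       parcs = sparkler_edges q p \<union> (sparkler_edges q p)\<inverse> \<rparr>"

lemma pair_graph_sparkler:
  assumes "1 \<le> q" "1 \<le> p"
  shows "pair_graph (sparkler q p)"
proof -
  have wf: "pair_wf_digraph (sparkler q p)"
    using assms by unfold_locales (auto simp: sparkler_def sparkler_edges_def)
  have "parcs (sparkler q p) \<subseteq> pverts (sparkler q p) \<times> pverts (sparkler q p)"
    using wf by (auto simp: pair_wf_digraph_def)
  moreover have "finite (pverts (sparkler q p))"
    by (simp add: sparkler_def)
  ultimately have fin: "finite (pverts (sparkler q p))" "finite (parcs (sparkler q p))"
    by (auto intro: finite_subset)
  interpret pair_wf_digraph "sparkler q p" by (rule wf)
  show ?thesis
    by unfold_locales
      (use fin in \<open>auto simp: sparkler_def sparkler_edges_def symmetric_def sym_def\<close>)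
qed

end

theory Submission
  imports Defs
begin

text \<open>Let \<open>v\<close> be a vertex of maximum degree \<open>D \<ge> q\<close>. If some vertex had distance at least \<open>p\<close>
  from \<open>v\<close>, the first \<open>p\<close> steps of a geodesic towards it, together with \<open>q - 1\<close> further neighbours
  of \<open>v\<close>, would form a sparkler: neighbours of \<open>v\<close> have distance 1, so only the first vertex of the
  geodesic is among them. Hence all vertices have distance less than \<open>p\<close> from \<open>v\<close>, and
  \<open>v(H) \<le> 1 + D + \<dots> + D^(p-1) \<le> D^p\<close>, which is stronger than required.\<close>

text \<open>There are at most \<open>D\<close> choices for each step of a walk. The layers consist
  of endpoints of walks of length exactly \<open>n\<close>, not of vertices at distance
  \<open>n\<close>; they may overlap, which is harmless for an upper bound.\<close>

lemma card_relpow_Image_le: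
  fixes E :: "'a rel" and D :: nat
  assumes fin: "\<And>u. finite (E `` {u})" and deg: "\<And>u. card (E `` {u}) \<le> D"
  shows "finite ((E ^^ n) `` {v}) \<and> card ((E ^^ n) `` {v}) \<le> D ^ n"
proof (induction n)
  case 0
  have "(E ^^ 0) `` {v} = {v}" by auto
  then show ?case by simp
next
  case (Suc n)
  let ?L = "(E ^^ n) `` {v}"
  have eq: "(E ^^ Suc n) `` {v} = (\<Union>u\<in>?L. E `` {u})" by auto
  have "card (\<Union>u\<in>?L. E `` {u}) \<le> (\<Sum>u\<in>?L. card (E `` {u}))"
    using Suc.IH by (intro card_UN_le) auto
  also have "\<dots> \<le> card ?L * D"
    using sum_bounded_above[of ?L "\<lambda>u. card (E `` {u})" D] deg by simp
  also have "\<dots> \<le> D ^ n * D" using Suc.IH by (intro mult_right_mono) auto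
  finally show ?case unfolding eq using Suc.IH fin by (auto simp: mult.commute)
qed

text \<open>The terms before the last sum to at most the last one, so the total at most doubles it,
  and \<open>2 \<le> D\<close> absorbs the factor.\<close>

lemma sum_power_le_power:
  fixes D :: nat
  assumes "2 \<le> D"
  shows "(\<Sum>i<p. D ^ i) \<le> D ^ p"
proof (induction p)
  case 0
  show ?case by simp
next
  case (Suc p)
  then have "(\<Sum>i<Suc p. D ^ i) \<le> 2 * D ^ p" by simp
  also have "\<dots> \<le> D * D ^ p" using assms by (intro mult_right_mono) auto
  finally show ?case by simp
qed

text \<open>Take the first \<open>p\<close> steps of a shortest walk to \<open>w\<close>: a repeated
  vertex, or an arc from \<open>v\<close> to a later vertex than \<open>f 1\<close>, would shorten
  it. The indices \<open>0..p\<close> give \<open>p + 1\<close> vertices: the centre of the sparkler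
  and its whole path.\<close>

lemma geodesic:
  assumes "(v, w) \<in> E\<^sup>*" and far: "\<And>i. i < p \<Longrightarrow> (v, w) \<notin> E ^^ i"
  obtains f where "f 0 = v" "\<And>i. i < p \<Longrightarrow> (f i, f (Suc i)) \<in> E" "inj_on f {..p}"
    "\<And>j. 2 \<le> j \<Longrightarrow> j \<le> p \<Longrightarrow> (v, f j) \<notin> E"
proof -
  define m where "m = (LEAST m. (v, w) \<in> E ^^ m)"
  from assms(1) obtain k where "(v, w) \<in> E ^^ k" by (auto simp: rtrancl_power)
  then have m: "(v, w) \<in> E ^^ m" unfolding m_def by (rule LeastI)
  have least: "m \<le> i" if "(v, w) \<in> E ^^ i" for i
    unfolding m_def using that by (rule Least_le)
  have "p \<le> m" using far m by (meson not_le)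
  obtain f where f: "f 0 = v" "f m = w" "\<And>i. i < m \<Longrightarrow> (f i, f (Suc i)) \<in> E"
    using m unfolding relpow_fun_conv by blast
  have seg: "(f i, f (i + d)) \<in> E ^^ d" if "i + d \<le> m" for i d
    unfolding relpow_fun_conv using f(3) that
    by (intro exI[of _ "\<lambda>k. f (i + k)"]) auto
  \<comment> \<open>Reaching \<open>f j\<close> in \<open>d\<close> steps and continuing along
    \<open>f\<close> takes \<open>d + (m - j)\<close> steps, so minimality of \<open>m\<close>
    forces \<open>j \<le> d\<close>.\<close>
  have shortcut: "m \<le> d + (m - j)" if "(v, f j) \<in> E ^^ d" "j \<le> m" for d j
  proof -
    have "(f j, w) \<in> E ^^ (m - j)" using seg[of j "m - j"] that(2) f(2) by simp
    with that(1) have "(v, w) \<in> E ^^ (d + (m - j))" by (auto simp: relpow_add)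
    then show ?thesis by (rule least)
  qed
  \<comment> \<open>If \<open>f i = f j\<close>, the initial segment of length \<open>i\<close> is a
    route to \<open>f j\<close>. Exchanging \<open>i\<close> and \<open>j\<close> gives
    equality.\<close>
  have inj: "j \<le> i" if "f i = f j" "i \<le> m" "j \<le> m" for i j
    using shortcut[of j i] seg[of 0 i] f(1) that by auto
  show thesis
  proof
    show "f 0 = v" by fact
    show "(f i, f (Suc i)) \<in> E" if "i < p" for i using f(3) that \<open>p \<le> m\<close> by simp
    show "inj_on f {..p}"
      using inj \<open>p \<le> m\<close> by (intro inj_onI) (metis atMost_iff le_antisym le_trans)
    show "(v, f j) \<notin> E" if "2 \<le> j" "j \<le> p" for j
    proof
      assume "(v, f j) \<in> E"
      then show False using shortcut[of j 1] that \<open>p \<le> m\<close> by simp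
    qed
  qed
qed

text \<open>The copy \<open>K\<close> is the image of \<open>S\<close> under \<open>g\<close> and
  carries only the images of arcs of \<open>S\<close>, so it need not be induced; the inverse of
  \<open>g\<close> is the isomorphism.\<close>

lemma subgraph_iso_if_embedding:
  fixes S :: "'b pair_pre_digraph" and H :: "'a pair_pre_digraph"
  assumes "pair_wf_digraph S" "pair_wf_digraph H"
    and inj: "inj_on g (pverts S)" and vs: "g ` pverts S \<subseteq> pverts H"
    and es: "\<And>x y. (x, y) \<in> parcs S \<Longrightarrow> (g x, g y) \<in> parcs H"
  shows "\<exists>K. subgraph K (with_proj H) \<and> digraph_iso K (with_proj S)"
proof -
  interpret S: pair_wf_digraph S by fact
  interpret H: pair_wf_digraph H by fact
  define K where "K = \<lparr>pverts = g ` pverts S, parcs = map_prod g g ` parcs S\<rparr>"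
  define h where "h = inv_into (pverts S) g"
  have hg: "h (g x) = x" if "x \<in> pverts S" for x
    unfolding h_def using inj that by (rule inv_into_f_f)
  have wfK: "pair_wf_digraph K"
    by unfold_locales (auto simp: K_def intro!: imageI dest: S.wellformed')
  have "subgraph (with_proj K) (with_proj H)"
    unfolding subgraph_def wf_digraph_wp_iff
    using wfK assms(2) vs es by (auto simp: K_def)
  moreover have "digraph_iso (with_proj K) (with_proj S)"
  proof -
    \<comment> \<open>\<open>digraph_iso\<close> demands equality of digraph records after applying
      \<open>f\<close>, so head and tail must be the projections used by
      \<open>with_proj\<close>.\<close>
    define f where
      "f = \<lparr>iso_verts = h, iso_arcs = map_prod h h, iso_head = snd, iso_tail = fst\<rparr>"
    have arcs: "map_prod h h (map_prod g g e) = e" if "e \<in> parcs S" for e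
      using that by (cases e) (auto simp: hg dest: S.wellformed')
    have "pre_digraph.digraph_isomorphism (with_proj K) f"
      unfolding pre_digraph.digraph_isomorphism_def wf_digraph_wp_iff
      using wfK arcs by (auto simp: f_def K_def hg intro!: inj_onI)
    moreover have "with_proj S = app_iso f (with_proj K)"
      using arcs by (auto simp: app_iso_def with_proj_def f_def K_def image_image hg cong: image_cong)
    ultimately show ?thesis unfolding digraph_iso_def by blast
  qed
  ultimately show ?thesis by blast
qed

lemma (in pair_graph) sparkler_embedding:
  assumes f0: "f 0 = v" and walk: "\<And>i. i < p \<Longrightarrow> (f i, f (Suc i)) \<in> parcs G"
    and inj: "inj_on f {..p}" and far: "\<And>j. 2 \<le> j \<Longrightarrow> j \<le> p \<Longrightarrow> (v, f j) \<notin> parcs G"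
    and deg: "q \<le> card (parcs G `` {v})" and "1 \<le> q" "1 \<le> p"
  shows "\<exists>K. subgraph K (with_proj G) \<and> digraph_iso K (with_proj (sparkler q p))"
proof -
  have sym: "(y, x) \<in> parcs G" if "(x, y) \<in> parcs G" for x y
    using pair_sym_arcs that by (auto simp: symmetric_def dest: symD)
  have "finite (parcs G `` {v})" using pair_finite_arcs by (rule finite_Image)
  \<comment> \<open>Discarding \<open>f 1\<close>, which starts the path, costs at most one
    neighbour of \<open>v\<close>; \<open>q - 1\<close> remain for the leaves
    \<open>Inl 1, ..., Inl (q - 1)\<close>.\<close>
  then have "card {1..<q} \<le> card (parcs G `` {v} - {f 1})"
    using deg by (auto simp: card_Diff_singleton_if)
  then obtain h where h: "inj_on h {1..<q}" "h ` {1..<q} \<subseteq> parcs G `` {v} - {f 1}"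
    using card_le_inj[of "{1..<q}" "parcs G `` {v} - {f 1}"] \<open>finite (parcs G `` {v})\<close> by auto
  have hv: "(v, h i) \<in> parcs G" "h i \<noteq> f 1" if "1 \<le> i" "i < q" for i
    using subsetD[OF h(2) imageI[of i]] that by auto
  have hne: "h i \<noteq> v" if "1 \<le> i" "i < q" for i
    using pair_no_loops[OF hv(1)[OF that]] by auto
  \<comment> \<open>For \<open>j = 1\<close> this is the choice of \<open>h\<close>; for larger
    \<open>j\<close>, \<open>h i\<close> is adjacent to \<open>v\<close> and \<open>f j\<close> is
    not.\<close>
  have hf: "h i \<noteq> f j" if "1 \<le> i" "i < q" "1 \<le> j" "j \<le> p" for i j
    using hv[OF that(1,2)] far[of j] that(3,4) by (cases "j = 1") force+
  have fv: "f j \<noteq> v" if "1 \<le> j" "j \<le> p" for j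
    using inj f0 that by (force dest: inj_onD[of f _ j 0])
  \<comment> \<open>The index shift is due to \<open>f 0\<close> being the centre: the path starts
    at \<open>f 1\<close>.\<close>
  define g where "g = case_sum (\<lambda>i. if i = 0 then v else h i) (\<lambda>i. f (Suc i))"
  have v: "v \<in> pverts G" using walk[of 0] f0 \<open>1 \<le> p\<close> by (auto dest: wellformed')
  have fvert: "f (Suc i) \<in> pverts G" if "i < p" for i
    using walk[OF that] by (auto dest: wellformed')
  show ?thesis
  proof (rule subgraph_iso_if_embedding)
    interpret S: pair_graph "sparkler q p"
      using \<open>1 \<le> q\<close> \<open>1 \<le> p\<close> by (rule pair_graph_sparkler)
    show "pair_wf_digraph (sparkler q p)" by unfold_locales
    show "pair_wf_digraph G" by unfold_locales
    show "inj_on g (pverts (sparkler q p))"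
    proof (rule inj_onI)
      fix x y assume xy: "x \<in> pverts (sparkler q p)" "y \<in> pverts (sparkler q p)" "g x = g y"
      have ff: "i = j" if "f (Suc i) = f (Suc j)" "i < p" "j < p" for i j
        using inj_onD[OF inj that(1)] that(2,3) by simp
      have hh: "i = j" if "h i = h j" "0 < i" "i < q" "0 < j" "j < q" for i j
        using inj_onD[OF h(1) that(1)] that(2-) by simp
      from xy show "x = y"
        by (auto simp: sparkler_def g_def Suc_le_eq hne hf fv hne[symmetric] hf[symmetric]
            fv[symmetric] split: if_splits dest: hh ff)
    qed
    show "g ` pverts (sparkler q p) \<subseteq> pverts G"
      using v fvert in_arcsD2[OF hv(1)] by (auto simp: sparkler_def g_def Suc_le_eq)
    show "(g x, g y) \<in> parcs G" if "(x, y) \<in> parcs (sparkler q p)" for x y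
      using that walk[of 0] \<open>1 \<le> p\<close> f0 hv(1) walk sym
      by (auto simp: sparkler_def sparkler_edges_def g_def)
  qed
qed

text \<open>Connectedness is defined through the symmetric closure, which leaves reachability
  unchanged here because the arcs are already symmetric.\<close>

lemma (in pair_sym_digraph) connected_imp_rtrancl:
  assumes "Digraph_Component.connected (with_proj G)" "u \<in> pverts G" "w \<in> pverts G"
  shows "(u, w) \<in> (parcs G)\<^sup>*"
proof -
  have "u \<rightarrow>\<^sup>*\<^bsub>with_proj (mk_symmetric (with_proj G))\<^esub> w"
    using assms by (auto simp: connected_def strongly_connected_def)
  then have "u \<rightarrow>\<^sup>*\<^bsub>with_proj G\<^esub> w"
    by (simp only: reachable_mk_symmetric_eq[OF pair_sym_arcs])
  then show ?thesis by (auto simp: reachable_conv)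
qed

lemma out_degree_with_proj: "out_degree (with_proj G) v = card (parcs G `` {v})"
proof -
  have "out_arcs (with_proj G) v = Pair v ` (parcs G `` {v})"
    by (force simp: out_arcs_def)
  then show ?thesis by (simp add: out_degree_def card_image inj_on_def)
qed

lemma (in pair_graph) card_verts_le_max_degree_power:
  assumes conn: "Digraph_Component.connected (with_proj G)"
    and free: "\<not> (\<exists>K. subgraph K (with_proj G) \<and> digraph_iso K (with_proj (sparkler q p)))"
    and "q \<le> max_degree (with_proj G)" "2 \<le> q" "1 \<le> p"
  shows "card (pverts G) \<le> max_degree (with_proj G) ^ p"
proof -
  define D where "D = max_degree (with_proj G)"
  have D: "D = Max ((\<lambda>v. card (parcs G `` {v})) ` pverts G)"
    by (simp add: D_def max_degree_def out_degree_with_proj)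
  have ne: "pverts G \<noteq> {}" using conn by (auto simp: connected_def strongly_connected_def)
  obtain v where v: "v \<in> pverts G" "card (parcs G `` {v}) = D"
    using Max_in[of "(\<lambda>v. card (parcs G `` {v})) ` pverts G"] ne pair_finite_verts
    unfolding D by fastforce
  \<comment> \<open>The layer bound asks for all \<open>u\<close> of the type, whereas the maximum
    ranges over vertices; other elements have no outgoing arcs.\<close>
  have deg: "card (parcs G `` {u}) \<le> D" for u
  proof (cases "u \<in> pverts G")
    case True
    then show ?thesis unfolding D using pair_finite_verts by (intro Max_ge) auto
  next
    case False
    then have "parcs G `` {u} = {}" by (auto dest: wellformed')
    then show ?thesis by simp
  qed
  have fin: "finite (parcs G `` {u})" for u using pair_finite_arcs by (rule finite_Image)
  note layer = card_relpow_Image_le[of "parcs G", OF fin deg]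
  \<comment> \<open>A vertex outside this union is reached by no walk of length below
    \<open>p\<close>, so a geodesic towards it yields the forbidden sparkler.\<close>
  have "pverts G \<subseteq> (\<Union>i<p. (parcs G ^^ i) `` {v})"
  proof (rule ccontr)
    assume "\<not> ?thesis"
    then obtain w where w: "w \<in> pverts G" and far: "\<And>i. i < p \<Longrightarrow> (v, w) \<notin> parcs G ^^ i" by auto
    obtain f where "f 0 = v" "\<And>i. i < p \<Longrightarrow> (f i, f (Suc i)) \<in> parcs G" "inj_on f {..p}"
      "\<And>j. 2 \<le> j \<Longrightarrow> j \<le> p \<Longrightarrow> (v, f j) \<notin> parcs G"
      using geodesic[OF connected_imp_rtrancl[OF conn v(1) w] far] by blast
    with sparkler_embedding[of f v p q] v(2) assms free show False
      by (auto simp: D_def)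
  qed
  then have "card (pverts G) \<le> card (\<Union>i<p. (parcs G ^^ i) `` {v})"
    using layer by (intro card_mono) auto
  also have "\<dots> \<le> (\<Sum>i<p. card ((parcs G ^^ i) `` {v}))" by (intro card_UN_le) auto
  also have "\<dots> \<le> (\<Sum>i<p. D ^ i)" using layer by (intro sum_mono) auto
  also have "\<dots> \<le> D ^ p" using assms by (intro sum_power_le_power) (simp add: D_def)
  finally show ?thesis by (simp add: D_def)
qed

theorem lemma6:
  fixes H :: "'a pair_pre_digraph" and q p :: nat
  assumes "q \<ge> 3" and "p \<ge> 2"
    and "pair_graph H" and "Digraph_Component.connected (with_proj H)"
    and "\<not> (\<exists>K. subgraph K (with_proj H) \<and> digraph_iso K (with_proj (sparkler q p)))"
  shows "max_degree (with_proj H) < q \<or>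
    real (max_degree (with_proj H)) \<ge> (real (card (pverts H)) / 3) powr (1 / (2 * real q * real p))"
proof (rule disjCI)
  define D where "D = max_degree (with_proj H)"
  define N where "N = 2 * q * p"
  assume "\<not> real (max_degree (with_proj H)) \<ge>
    (real (card (pverts H)) / 3) powr (1 / (2 * real q * real p))"
  then have lt: "real D < (real (card (pverts H)) / 3) powr (1 / real N)"
    by (simp add: D_def N_def)
  show "max_degree (with_proj H) < q"
  proof (rule ccontr)
    assume "\<not> ?thesis"
    then have "q \<le> D" by (simp add: D_def)
    interpret pair_graph H by fact
    have "card (pverts H) \<le> D ^ p"
      using card_verts_le_max_degree_power[OF assms(4,5)] assms(1,2) \<open>q \<le> D\<close> by (simp add: D_def)
    \<comment> \<open>The exponent is raised from \<open>p\<close> to \<open>N\<close> so that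
      taking the \<open>N\<close>-th root returns exactly \<open>D\<close>.\<close>
    also have "\<dots> \<le> D ^ N"
      using assms(1) \<open>q \<le> D\<close> by (intro power_increasing) (auto simp: N_def)
    finally have "real (card (pverts H)) \<le> real D ^ N"
      by (metis of_nat_le_iff of_nat_power)
    moreover have "0 \<le> real D ^ N" by simp
    ultimately have "real (card (pverts H)) / 3 \<le> real D ^ N" by linarith
    then have "(real (card (pverts H)) / 3) powr (1 / real N) \<le> (real D ^ N) powr (1 / real N)"
      by (intro powr_mono2) auto
    \<comment> \<open>Rewriting the natural power as \<open>powr\<close> needs \<open>D > 0\<close>,
      which follows from \<open>3 \<le> q \<le> D\<close>.\<close>
    also have "\<dots> = real D"
      using assms(1,2) \<open>q \<le> D\<close> by (simp add: powr_realpow[symmetric] powr_powr N_def)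
    finally show False using lt by simp
  qed
qed

end
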